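(* Let $k \in \mathbb{N}$. There exists a constant $c_k$ such that if $m,n \in \mathbb{N}$ and $A$ is an $m \times n$ $(0,1)$-matrix satisfying (i) at least $c_k n$ of the entries of $A$ are $1$, and (ii) the rows of $A$ are pairwise different, then $A$ contains some member of each class of $\mathcal{M}(k)$.
   Context: For $k \times k$ matrices $K$ and $L$, $(K,L)$ denotes the $k \times 2k$ matrix obtained by putting $K$ in front of (to the left of) $L$. Two matrices $C$ and $D$ are equivalent, $C \sim D$, if $D$ is obtained from $C$ by permuting its rows. $\mathcal{M}(k)$ denotes the set of equivalence classes, with respect to $\sim$, in the family of all matrices $(K,L)$ where $K$ and $L$ are $k \times k$ permutation matrices. (Every such matrix is equivalent to a unique matrix $(I,M)$ with $I$ the $k\times k$ identity matrix and $M$ a permutation matrix, so $|\mathcal{M}(k)| = k!$.) For $(0,1)$-matrices $P$ and $Q$, $Q$ is a sub-matrix of $P$ if it is obtained from $P$ by deleting rows and columns (keeping the order of the remaining ones). $P$ contains $Q = (q_{ij})$ if there is a sub-matrix $R = (r_{ij})$ of $P$, of the same size as $Q$, with $r_{ij} = 1$ whenever $q_{ij} = 1$. *)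

theory Defs
  imports Complex_Main "HOL-Combinatorics.Permutations" "Jordan_Normal_Form.DL_Submatrix"
begin

definition zero_one_mat :: "nat mat \<Rightarrow> bool" where
  "zero_one_mat A \<longleftrightarrow> elements_mat A \<subseteq> {0, 1}"

definition permutation_mat :: "nat \<Rightarrow> nat mat \<Rightarrow> bool" where
  "permutation_mat k K \<longleftrightarrow> K \<in> carrier_mat k k \<and> zero_one_mat K \<and>
     (\<forall>i<k. \<exists>!j. j < k \<and> K $$ (i, j) = 1) \<and>
     (\<forall>j<k. \<exists>!i. i < k \<and> K $$ (i, j) = 1)"

text \<open>The matrix \<open>(K, L)\<close>: the lower two blocks have no rows.\<close>

definition append_cols :: "nat mat \<Rightarrow> nat mat \<Rightarrow> nat mat" where
  "append_cols K L = four_block_mat K L (0\<^sub>m 0 (dim_col K)) (0\<^sub>m 0 (dim_col L))"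

definition permute_mat_rows :: "(nat \<Rightarrow> nat) \<Rightarrow> nat mat \<Rightarrow> nat mat" where
  "permute_mat_rows p C = mat (dim_row C) (dim_col C) (\<lambda>(i, j). C $$ (p i, j))"

definition row_equivalent :: "nat mat \<Rightarrow> nat mat \<Rightarrow> bool" (infix \<open>\<sim>\<^sub>r\<close> 50) where
  "C \<sim>\<^sub>r D \<longleftrightarrow> (\<exists>p. p permutes {..<dim_row C} \<and> D = permute_mat_rows p C)"

definition perm_pair_mats :: "nat \<Rightarrow> nat mat set" where
  "perm_pair_mats k = {append_cols K L | K L. permutation_mat k K \<and> permutation_mat k L}"

definition perm_pair_rel :: "nat \<Rightarrow> (nat mat \<times> nat mat) set" where
  "perm_pair_rel k = {(C, D). C \<in> perm_pair_mats k \<and> D \<in> perm_pair_mats k \<and> C \<sim>\<^sub>r D}"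

definition perm_pair_classes :: "nat \<Rightarrow> nat mat set set" where
  "perm_pair_classes k = perm_pair_mats k // perm_pair_rel k"

text \<open>The sets \<open>I\<close> and \<open>J\<close> consist of the rows and columns that are kept;
  \<^const>\<open>submatrix\<close> lists them in increasing order.\<close>

definition is_submatrix :: "nat mat \<Rightarrow> nat mat \<Rightarrow> bool" where
  "is_submatrix Q P \<longleftrightarrow> (\<exists>I \<subseteq> {..<dim_row P}. \<exists>J \<subseteq> {..<dim_col P}. Q = submatrix P I J)"

definition mat_contains :: "nat mat \<Rightarrow> nat mat \<Rightarrow> bool" where
  "mat_contains P Q \<longleftrightarrow> (\<exists>R. is_submatrix R P \<and> R \<in> carrier_mat (dim_row Q) (dim_col Q) \<and>
     (\<forall>i<dim_row Q. \<forall>j<dim_col Q. Q $$ (i, j) = 1 \<longrightarrow> R $$ (i, j) = 1))"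

definition num_ones :: "nat mat \<Rightarrow> nat" where
  "num_ones A = card {(i, j). i < dim_row A \<and> j < dim_col A \<and> A $$ (i, j) = 1}"

lemma dim_permute_mat_rows [simp]:
  "dim_row (permute_mat_rows p C) = dim_row C"
  "dim_col (permute_mat_rows p C) = dim_col C"
  by (simp_all add: permute_mat_rows_def)

lemma row_equivalent_refl: "C \<sim>\<^sub>r C"
proof -
  have "C = permute_mat_rows id C"
    unfolding permute_mat_rows_def by (rule eq_matI) simp_all
  then show ?thesis
    unfolding row_equivalent_def using permutes_id by blast
qed

lemma row_equivalent_sym:
  assumes "C \<sim>\<^sub>r D" shows "D \<sim>\<^sub>r C"
proof -
  from assms obtain p where p: "p permutes {..<dim_row C}" and D: "D = permute_mat_rows p C"
    unfolding row_equivalent_def by blast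
  define q where "q = Hilbert_Choice.inv p"
  have q: "q permutes {..<dim_row C}"
    unfolding q_def using p by (rule permutes_inv)
  have lt: "q i < dim_row C" if "i < dim_row C" for i
    using permutes_in_image[OF q, of i] that by simp
  have pq: "p (q i) = i" for i
    unfolding q_def using p by (rule permutes_inverses)
  have "C = permute_mat_rows q D"
    unfolding D permute_mat_rows_def by (rule eq_matI) (simp_all add: lt pq)
  moreover have "dim_row D = dim_row C"
    by (simp add: D)
  ultimately show ?thesis
    unfolding row_equivalent_def using q by metis
qed

lemma row_equivalent_trans:
  assumes "C \<sim>\<^sub>r D" "D \<sim>\<^sub>r E" shows "C \<sim>\<^sub>r E"
proof -
  from assms(1) obtain p where p: "p permutes {..<dim_row C}" and D: "D = permute_mat_rows p C"
    unfolding row_equivalent_def by blast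
  have dim: "dim_row D = dim_row C"
    by (simp add: D)
  from assms(2) obtain q where q: "q permutes {..<dim_row C}" and E: "E = permute_mat_rows q D"
    unfolding row_equivalent_def dim by blast
  have lt: "q i < dim_row C" if "i < dim_row C" for i
    using permutes_in_image[OF q, of i] that by simp
  have "E = permute_mat_rows (p \<circ> q) C"
    unfolding E D permute_mat_rows_def by (rule eq_matI) (simp_all add: lt)
  with permutes_compose[OF q p] show ?thesis
    unfolding row_equivalent_def by blast
qed

lemma equiv_perm_pair_rel: "equiv (perm_pair_mats k) (perm_pair_rel k)"
proof (rule equivI)
  show "perm_pair_rel k \<subseteq> perm_pair_mats k \<times> perm_pair_mats k"
    unfolding perm_pair_rel_def by blast
  show "refl_on (perm_pair_mats k) (perm_pair_rel k)"
    unfolding perm_pair_rel_def refl_on_def using row_equivalent_refl by blast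
  show "sym (perm_pair_rel k)"
    unfolding perm_pair_rel_def sym_def using row_equivalent_sym by blast
  show "trans (perm_pair_rel k)"
    unfolding perm_pair_rel_def trans_def using row_equivalent_trans by blast
qed

end

theory Submission
  imports Defs "HOL-Library.Infinite_Set" "HOL-Library.FuncSet"
begin

text \<open>
  Regard the rows as distinct subsets of \<open>{..<n}\<close>, and let \<open>c\<close> be the Marcus--Tardos constant of the
  patterns with \<open>k + 1\<close> points. Cut each row of size at least \<open>L = 2c + 2\<close> into pieces of \<open>L\<close>
  consecutive elements, keep each smaller row as a single piece, and choose a maximal system of
  distinct pairs representing pieces. If the graph \<open>G\<close> of these pairs contains pairs
  \<open>x i < y i\<close> in the desired order with all \<open>x i\<close> to the left of all \<open>y j\<close>, then they come
  from different rows, because pieces of the same row lie in disjoint intervals, whereas the intervals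
  from \<open>x i\<close> to \<open>y i\<close> overlap. Otherwise \<open>G\<close> has at most \<open>c\<close> edges per vertex on every set of
  vertices. By maximality every unrepresented piece is a clique of \<open>G\<close>, hence has fewer than \<open>L\<close>
  elements and is an entire row, and there are at most \<open>2\<^sup>2\<^sup>c n\<close> nonempty cliques. So there are
  \<open>O(n)\<close> pieces and \<open>O(n)\<close> ones.
\<close>

subsection \<open>The Marcus--Tardos theorem\<close>

text \<open>A pattern consists of \<open>k\<close> points, ranked by \<open>\<rho>\<close> in the first and by \<open>\<pi>\<close> in the second coordinate.
  Two rankings instead of one permutation make the notion symmetric under transposition.\<close>

definition contains_pattern ::
  "nat \<Rightarrow> (nat \<Rightarrow> nat) \<Rightarrow> (nat \<Rightarrow> nat) \<Rightarrow> (nat \<times> nat) set \<Rightarrow> bool" where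
  "contains_pattern k \<rho> \<pi> E \<longleftrightarrow> (\<exists>x y. (\<forall>i<k. (x i, y i) \<in> E) \<and>
     (\<forall>i<k. \<forall>j<k. \<rho> i < \<rho> j \<longrightarrow> x i < x j) \<and> (\<forall>i<k. \<forall>j<k. \<pi> i < \<pi> j \<longrightarrow> y i < y j))"

lemma contains_patternI:
  assumes "\<And>i. i < k \<Longrightarrow> (x i, y i) \<in> E"
    and "\<And>i j. i < k \<Longrightarrow> j < k \<Longrightarrow> \<rho> i < \<rho> j \<Longrightarrow> x i < x j"
    and "\<And>i j. i < k \<Longrightarrow> j < k \<Longrightarrow> \<pi> i < \<pi> j \<Longrightarrow> y i < y j"
  shows "contains_pattern k \<rho> \<pi> E"
  unfolding contains_pattern_def using assms by (intro exI[of _ x] exI[of _ y]) simp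

lemma contains_patternE:
  assumes "contains_pattern k \<rho> \<pi> E"
  obtains x y where "\<And>i. i < k \<Longrightarrow> (x i, y i) \<in> E"
    and "\<And>i j. i < k \<Longrightarrow> j < k \<Longrightarrow> \<rho> i < \<rho> j \<Longrightarrow> x i < x j"
    and "\<And>i j. i < k \<Longrightarrow> j < k \<Longrightarrow> \<pi> i < \<pi> j \<Longrightarrow> y i < y j"
proof -
  obtain x y where "\<forall>i<k. (x i, y i) \<in> E" "\<forall>i<k. \<forall>j<k. \<rho> i < \<rho> j \<longrightarrow> x i < x j"
    "\<forall>i<k. \<forall>j<k. \<pi> i < \<pi> j \<longrightarrow> y i < y j"
    using assms unfolding contains_pattern_def by (elim exE conjE)
  then show thesis by (intro that[of x y]) simp_all
qed

text \<open>Transposition exchanges the two rankings; tall blocks are thereby reduced to wide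
  ones.\<close>

lemma contains_pattern_converse:
  assumes "contains_pattern k \<rho> \<pi> (E\<inverse>)"
  shows "contains_pattern k \<pi> \<rho> E"
  using assms
proof (rule contains_patternE)
  fix x y
  assume "\<And>i. i < k \<Longrightarrow> (x i, y i) \<in> E\<inverse>"
    and "\<And>i j. i < k \<Longrightarrow> j < k \<Longrightarrow> \<rho> i < \<rho> j \<Longrightarrow> x i < x j"
    and "\<And>i j. i < k \<Longrightarrow> j < k \<Longrightarrow> \<pi> i < \<pi> j \<Longrightarrow> y i < y j"
  then show ?thesis by (intro contains_patternI[of k y x]) simp_all
qed

text \<open>Since strict order between values of \<open>f\<close> passes to arbitrary preimages, a
  preimage edge can be chosen for each point independently. With \<open>f\<close> the division by
  \<open>s\<close>, this says that contracting blocks to points creates no new pattern.\<close>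

lemma contains_pattern_pullback:
  assumes "contains_pattern k \<rho> \<pi> F"
    and ex: "\<And>a b. (a, b) \<in> F \<Longrightarrow> \<exists>x y. (x, y) \<in> E \<and> f x = a \<and> f y = b"
    and mono: "\<And>x y. f x < f y \<Longrightarrow> x < y"
  shows "contains_pattern k \<rho> \<pi> E"
  using assms(1)
proof (rule contains_patternE)
  fix a b
  assume F: "\<And>i. i < k \<Longrightarrow> (a i, b i) \<in> F"
    and a: "\<And>i j. i < k \<Longrightarrow> j < k \<Longrightarrow> \<rho> i < \<rho> j \<Longrightarrow> a i < a j"
    and b: "\<And>i j. i < k \<Longrightarrow> j < k \<Longrightarrow> \<pi> i < \<pi> j \<Longrightarrow> b i < b j"
  have "\<exists>e. i < k \<longrightarrow> e \<in> E \<and> f (fst e) = a i \<and> f (snd e) = b i" for i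
  proof (cases "i < k")
    case True
    then show ?thesis using ex[OF F[OF True]] by auto
  qed simp
  then obtain e where e: "\<And>i. i < k \<Longrightarrow> e i \<in> E"
    and fe: "\<And>i. i < k \<Longrightarrow> f (fst (e i)) = a i" "\<And>i. i < k \<Longrightarrow> f (snd (e i)) = b i"
    by metis
  show ?thesis
  proof (rule contains_patternI)
    show "(fst (e i), snd (e i)) \<in> E" if "i < k" for i using e[OF that] by simp
    show "fst (e i) < fst (e j)" if "i < k" "j < k" "\<rho> i < \<rho> j" for i j
      by (rule mono) (simp add: fe that a)
    show "snd (e i) < snd (e j)" if "i < k" "j < k" "\<pi> i < \<pi> j" for i j
      by (rule mono) (simp add: fe that b)
  qed
qed

section \<open>Blocks of side \<open>s\<close> and their contraction\<close>

text \<open>Columns are recorded by their residues, so that all blocks yield subsets of the same set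
  \<open>{..<s}\<close> and the pigeonhole principle applies.\<close>

definition block_columns :: "nat \<Rightarrow> (nat \<times> nat) set \<Rightarrow> nat \<Rightarrow> nat \<Rightarrow> nat set" where
  "block_columns s E i j = {y mod s | x y. (x, y) \<in> E \<and> x div s = i \<and> y div s = j}"

text \<open>With more than \<open>k * 2 ^ s\<close> wide blocks above each other, pigeonhole gives a
  set \<open>D\<close> of more than \<open>k\<close> of them with the same set \<open>C\<close> of
  nonempty columns, where \<open>C\<close> has at least \<open>k\<close> elements. Each of these
  blocks offers a point in every column of \<open>C\<close>, so the pattern appears: its point
  \<open>i\<close> is taken in block number \<open>\<rho> i\<close> of \<open>D\<close> and column
  number \<open>\<pi> i\<close> of \<open>C\<close>.\<close>

lemma card_wide_blocks_in_column:
  assumes s: "s > 0" and avoid: "\<not> contains_pattern k \<rho> \<pi> E"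
    and rk: "\<And>i. i < k \<Longrightarrow> \<rho> i < k \<and> \<pi> i < k"
  shows "card {i. i < N \<and> k \<le> card (block_columns s E i j)} \<le> k * 2 ^ s"
proof (rule ccontr)
  let ?A = "{i. i < N \<and> k \<le> card (block_columns s E i j)}"
  assume "\<not> ?thesis"
  then have big: "k * 2 ^ s < card ?A" by simp
  have sub: "block_columns s E i j \<subseteq> {..<s}" for i
    unfolding block_columns_def using s by auto
  have "\<exists>C\<in>Pow {..<s}. card ((\<lambda>i. block_columns s E i j) -` {C} \<inter> ?A) * card (Pow {..<s}) \<ge> card ?A"
    by (rule pigeonhole_card) (use sub in auto)
  then obtain C where C: "C \<subseteq> {..<s}"
    and le: "card ?A \<le> card ((\<lambda>i. block_columns s E i j) -` {C} \<inter> ?A) * 2 ^ s"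
    by (auto simp: card_Pow)
  define D where "D = (\<lambda>i. block_columns s E i j) -` {C} \<inter> ?A"
  have finD: "finite D" unfolding D_def by auto
  have finC: "finite C" using C finite_subset by blast
  have cD: "k < card D"
  proof -
    have "k * 2 ^ s < card D * 2 ^ s" using big le unfolding D_def by linarith
    then show ?thesis by simp
  qed
  then have "D \<noteq> {}" by auto
  then have cC: "k \<le> card C" unfolding D_def by auto
  have "\<forall>i. \<exists>x. i < k \<longrightarrow> x div s = enumerate D (\<rho> i) \<and> (x, j * s + enumerate C (\<pi> i)) \<in> E"
  proof (intro allI)
    fix i
    show "\<exists>x. i < k \<longrightarrow> x div s = enumerate D (\<rho> i) \<and> (x, j * s + enumerate C (\<pi> i)) \<in> E"
    proof (cases "i < k")
      case True
      then have "enumerate D (\<rho> i) \<in> D"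
        using finite_enumerate_in_set[OF finD] rk[of i] cD by simp
      then have "block_columns s E (enumerate D (\<rho> i)) j = C" unfolding D_def by auto
      moreover have "enumerate C (\<pi> i) \<in> C"
        using True finite_enumerate_in_set[OF finC] rk[of i] cC by simp
      ultimately have "enumerate C (\<pi> i) \<in> block_columns s E (enumerate D (\<rho> i)) j" by simp
      then obtain x y where mod: "enumerate C (\<pi> i) = y mod s" and xy: "(x, y) \<in> E"
        "x div s = enumerate D (\<rho> i)" and div: "y div s = j"
        unfolding block_columns_def by blast
      have "j * s + enumerate C (\<pi> i) = y"
        unfolding mod div[symmetric] by (rule div_mult_mod_eq)
      then show ?thesis using xy by auto
    qed simp
  qed
  from choice[OF this] obtain x where x: "\<And>i. i < k \<Longrightarrow> x i div s = enumerate D (\<rho> i)"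
    "\<And>i. i < k \<Longrightarrow> (x i, j * s + enumerate C (\<pi> i)) \<in> E"
    by blast
  have "x i < x j" if "i < k" "j < k" "\<rho> i < \<rho> j" for i j
  proof -
    have "x i div s < x j div s"
      using that x(1) rk[of j] cD finite_enumerate_mono[OF that(3) finD] by simp
    then show ?thesis using div_le_mono[of "x j" "x i" s] by linarith
  qed
  moreover have "enumerate C (\<pi> i) < enumerate C (\<pi> j)" if "i < k" "j < k" "\<pi> i < \<pi> j" for i j
    using that rk[of j] cC finite_enumerate_mono[OF that(3) finC] by simp
  ultimately have "contains_pattern k \<rho> \<pi> E"
    using x(2) by (intro contains_patternI[of k x "\<lambda>i. j * s + enumerate C (\<pi> i)"]) simp_all
  with avoid show False by simp
qed

lemma card_wide_blocks:
  assumes "s > 0" "\<not> contains_pattern k \<rho> \<pi> E" "\<And>i. i < k \<Longrightarrow> \<rho> i < k \<and> \<pi> i < k"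
  shows "card {(i, j). i < N \<and> j < N \<and> k \<le> card (block_columns s E i j)} \<le> N * (k * 2 ^ s)"
proof -
  let ?W = "\<lambda>j. {i. i < N \<and> k \<le> card (block_columns s E i j)}"
  have "card {(i, j). i < N \<and> j < N \<and> k \<le> card (block_columns s E i j)}
      = card (prod.swap ` (SIGMA j:{..<N}. ?W j))"
    by (rule arg_cong[where f = card]) (auto simp: image_iff)
  also have "\<dots> \<le> card (SIGMA j:{..<N}. ?W j)"
    by (intro card_image_le finite_SigmaI) auto
  also have "\<dots> = (\<Sum>j<N. card (?W j))" by (subst card_SigmaI) auto
  also have "\<dots> \<le> of_nat (card {..<N}) * (k * 2 ^ s)"
    by (rule sum_bounded_above) (rule card_wide_blocks_in_column[OF assms])
  finally show ?thesis by simp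
qed

text \<open>Wide or tall blocks are few, and each holds at most \<open>s * s\<close> points. Any
  other nonempty block has fewer than \<open>k\<close> nonempty rows and columns, hence at most
  \<open>(k - 1) * (k - 1)\<close> points, and is one point of the contraction.\<close>

lemma block_contraction_bound:
  assumes s: "s > 0" and avoid: "\<not> contains_pattern k \<rho> \<pi> E"
    and rk: "\<And>i. i < k \<Longrightarrow> \<rho> i < k \<and> \<pi> i < k"
    and E: "E \<subseteq> {..<N * s} \<times> {..<N * s}"
  shows "card E \<le> 2 * (N * (k * 2 ^ s)) * (s * s) +
    (k - 1) * (k - 1) * card ((\<lambda>(x, y). (x div s, y div s)) ` E)"
proof -
  define g where "g = (\<lambda>(x, y). (x div s, y div s :: nat))"
  define blk where "blk b = {e \<in> E. g e = b}" for b
  define cols where "cols = (\<lambda>(i, j). block_columns s E i j)"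
  \<comment> \<open>Rows are the columns of the converse relation, with block indices exchanged;
    this makes \<open>card_wide_blocks\<close> usable for both.\<close>
  define rws where "rws = (\<lambda>(i, j). block_columns s (E\<inverse>) j i)"
  define V where "V = {(i, j). i < N \<and> j < N \<and> k \<le> card (block_columns s E i j)}"
  define T where "T = {(i, j). i < N \<and> j < N \<and> k \<le> card (block_columns s (E\<inverse>) i j)}"
  define U where "U = V \<union> prod.swap ` T"
  have finE: "finite E" using E finite_subset by blast
  have finV: "finite V" unfolding V_def
    by (rule finite_subset[of _ "{..<N} \<times> {..<N}"]) auto
  have finT: "finite T" unfolding T_def
    by (rule finite_subset[of _ "{..<N} \<times> {..<N}"]) auto
  have finU: "finite U" unfolding U_def using finV finT by simp
  have "card V \<le> N * (k * 2 ^ s)"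
    unfolding V_def by (rule card_wide_blocks[OF s avoid rk])
  moreover have "card T \<le> N * (k * 2 ^ s)"
    unfolding T_def
    by (rule card_wide_blocks[OF s, where \<rho> = \<pi> and \<pi> = \<rho>])
      (use avoid rk contains_pattern_converse in blast)+
  moreover have "card U \<le> card V + card T"
    using card_Un_le[of V "prod.swap ` T"] card_image_le[OF finT, of prod.swap]
    unfolding U_def by linarith
  ultimately have cU: "card U \<le> 2 * (N * (k * 2 ^ s))" by linarith
  have fcols: "cols b \<subseteq> {..<s}" "rws b \<subseteq> {..<s}" for b
    unfolding cols_def rws_def block_columns_def using s by (auto split: prod.splits)
  then have cc: "card (cols b) \<le> s" "card (rws b) \<le> s" for b
    by (metis card_lessThan card_mono finite_lessThan)+
  have blk_le: "card (blk b) \<le> card (rws b) * card (cols b)" for b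
  proof -
    have "inj_on (\<lambda>(x, y). (x mod s, y mod s)) (blk b)"
    proof (rule inj_onI)
      fix e e' assume "e \<in> blk b" "e' \<in> blk b"
        "(\<lambda>(x, y). (x mod s, y mod s)) e = (\<lambda>(x, y). (x mod s, y mod s)) e'"
      then have "fst e div s = fst e' div s" "snd e div s = snd e' div s"
        "fst e mod s = fst e' mod s" "snd e mod s = snd e' mod s"
        unfolding blk_def g_def by (auto split: prod.splits)
      then show "e = e'" by (metis div_mult_mod_eq prod.collapse)
    qed
    moreover have "(\<lambda>(x, y). (x mod s, y mod s)) ` blk b \<subseteq> rws b \<times> cols b"
      unfolding blk_def g_def rws_def cols_def block_columns_def by auto
    moreover have "finite (rws b \<times> cols b)"
      using fcols by (meson finite_SigmaI finite_lessThan finite_subset)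
    ultimately have "card (blk b) \<le> card (rws b \<times> cols b)" by (rule card_inj_on_le)
    then show ?thesis by (simp add: card_cartesian_product)
  qed
  have big: "card (blk b) \<le> s * s" for b
    using blk_le[of b] mult_le_mono[OF cc(2)[of b] cc(1)[of b]] by linarith
  have small: "card (blk b) \<le> (k - 1) * (k - 1)" if "b \<in> g ` E - U" for b
  proof -
    obtain i j where b: "b = (i, j)" by force
    have "i < N" "j < N"
      using that E unfolding b g_def by (auto simp: less_mult_imp_div_less)
    then have "card (cols b) < k" "card (rws b) < k"
      using that unfolding b U_def V_def T_def cols_def rws_def by (auto simp: image_iff)
    then have "card (rws b) * card (cols b) \<le> (k - 1) * (k - 1)"
      by (intro mult_le_mono) auto
    then show ?thesis using blk_le[of b] by linarith
  qed
  have "card E = card (\<Union>b\<in>g ` E. blk b)"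
    by (rule arg_cong[where f = card]) (auto simp: blk_def)
  also have "\<dots> \<le> (\<Sum>b\<in>g ` E. card (blk b))"
    using finE by (intro card_UN_le) auto
  also have "\<dots> \<le> (\<Sum>b\<in>U \<union> (g ` E - U). card (blk b))"
    using finE finU by (intro sum_mono2) auto
  also have "\<dots> = (\<Sum>b\<in>U. card (blk b)) + (\<Sum>b\<in>g ` E - U. card (blk b))"
    using finE finU by (intro sum.union_disjoint) auto
  also have "(\<Sum>b\<in>U. card (blk b)) \<le> of_nat (card U) * (s * s)"
    by (rule sum_bounded_above) (rule big)
  also have "(\<Sum>b\<in>g ` E - U. card (blk b)) \<le> of_nat (card (g ` E - U)) * ((k - 1) * (k - 1))"
    by (rule sum_bounded_above) (rule small)
  also have "of_nat (card (g ` E - U)) * ((k - 1) * (k - 1)) \<le> (k - 1) * (k - 1) * card (g ` E)"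
    using finE by (simp add: card_mono mult.commute)
  also have "of_nat (card U) * (s * s) \<le> 2 * (N * (k * 2 ^ s)) * (s * s)"
    using cU mult_le_mono1 by simp
  finally show ?thesis unfolding g_def by simp
qed

text \<open>Induction on \<open>p\<close> by contracting blocks. One step costs a term linear in the
  side \<open>s ^ p\<close> and multiplies the previous bound by \<open>(k - 1) * (k - 1)\<close>;
  the recursion closes because \<open>s\<close> is at least
  \<open>1 + (k - 1) * (k - 1)\<close>.\<close>

lemma marcus_tardos_power:
  fixes k :: nat
  defines "s \<equiv> k * k + 1"
  assumes k: "k \<ge> 1" and rk: "\<And>i. i < k \<Longrightarrow> \<rho> i < k \<and> \<pi> i < k"
    and "\<not> contains_pattern k \<rho> \<pi> E" "E \<subseteq> {..<s ^ p} \<times> {..<s ^ p}"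
  shows "card E \<le> 2 * (k * 2 ^ s) * (s * s) * s ^ p"
  using assms(4,5)
proof (induction p arbitrary: E)
  case 0
  then have "card E \<le> card ({..<1::nat} \<times> {..<1::nat})"
    by (intro card_mono) auto
  also have "\<dots> = 1" by simp
  also have "1 \<le> 2 * (k * 2 ^ s) * (s * s) * s ^ 0"
  proof -
    have "2 * (k * 2 ^ s) * (s * s) * s ^ 0 > 0" using k unfolding s_def by simp
    then show ?thesis by linarith
  qed
  finally show ?case .
next
  case (Suc p)
  define c where "c = 2 * (k * 2 ^ s) * (s * s)"
  define F where "F = (\<lambda>(x, y). (x div s, y div s)) ` E"
  have s: "s > 0" unfolding s_def by simp
  have E: "E \<subseteq> {..<s ^ p * s} \<times> {..<s ^ p * s}" using Suc.prems by (simp add: mult.commute)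
  have "\<not> contains_pattern k \<rho> \<pi> F"
  proof
    assume "contains_pattern k \<rho> \<pi> F"
    then have "contains_pattern k \<rho> \<pi> E"
    proof (rule contains_pattern_pullback)
      show "\<exists>x y. (x, y) \<in> E \<and> x div s = a \<and> y div s = b" if "(a, b) \<in> F" for a b
        using that unfolding F_def by auto
      show "x < y" if "x div s < y div s" for x y
        using that div_le_mono[of y x s] by linarith
    qed
    with Suc.prems show False by simp
  qed
  moreover have "F \<subseteq> {..<s ^ p} \<times> {..<s ^ p}"
    unfolding F_def using E by (auto simp: less_mult_imp_div_less)
  ultimately have F: "card F \<le> c * s ^ p" unfolding c_def by (rule Suc.IH)
  have "card E \<le> 2 * (s ^ p * (k * 2 ^ s)) * (s * s) + (k - 1) * (k - 1) * card F"
    unfolding F_def by (rule block_contraction_bound[OF s Suc.prems(1) rk E])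
  also have "\<dots> \<le> c * s ^ p + (k - 1) * (k - 1) * (c * s ^ p)"
    using mult_le_mono2[OF F, of "(k - 1) * (k - 1)"] by (simp add: c_def ac_simps)
  also have "\<dots> = c * s ^ p * (1 + (k - 1) * (k - 1))" by (simp add: algebra_simps)
  also have "\<dots> \<le> c * s ^ p * s"
    unfolding s_def by (intro mult_le_mono) (simp_all add: mult_le_mono)
  finally show ?case unfolding c_def by (simp add: ac_simps)
qed

text \<open>The increasing enumeration of \<open>W\<close> carries \<open>E\<close> to a board of
  side \<open>n = card W\<close>, which fits into one whose side is the least power of
  \<open>s\<close> above \<open>n\<close>. That power is at most \<open>s * n\<close>, whence the
  extra factor \<open>s\<close>. Allowing any finite \<open>W\<close> prepares the later use on all
  vertex subsets of one graph.\<close>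

theorem marcus_tardos:
  assumes k: "k \<ge> 1"
  shows "\<exists>c. \<forall>\<rho> \<pi> W E. (\<forall>i<k. \<rho> i < k \<and> \<pi> i < k) \<longrightarrow> finite W \<longrightarrow> E \<subseteq> W \<times> W \<longrightarrow>
    \<not> contains_pattern k \<rho> \<pi> E \<longrightarrow> card E \<le> c * card W"
proof -
  define s where "s = k * k + 1"
  define c where "c = 2 * (k * 2 ^ s) * (s * s)"
  have "card E \<le> (c * s) * card W"
    if rk: "\<forall>i<k. \<rho> i < k \<and> \<pi> i < k" and W: "finite W" and E: "E \<subseteq> W \<times> W"
      and avoid: "\<not> contains_pattern k \<rho> \<pi> E" for \<rho> \<pi> W E
  proof (cases "W = {}")
    case True
    then show ?thesis using E by simp
  next
    case False
    define n where "n = card W"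
    define h where "h = enumerate W"
    define F where "F = {(i, j). i < n \<and> j < n \<and> (h i, h j) \<in> E}"
    have n: "n \<ge> 1" using False W unfolding n_def by (simp add: Suc_le_eq card_gt_0_iff)
    have h: "bij_betw h {..<n} W"
      unfolding h_def n_def using W by (rule finite_bij_enumerate)
    have mono: "h i < h j" if "i < j" "j < n" for i j
      using finite_enumerate_mono[OF that(1) W] that unfolding h_def n_def by simp
    have "E \<subseteq> (\<lambda>(i, j). (h i, h j)) ` F"
    proof (clarify)
      fix x y assume xy: "(x, y) \<in> E"
      with E have "x \<in> h ` {..<n}" "y \<in> h ` {..<n}" using h by (auto simp: bij_betw_def)
      then obtain i j where "i < n" "j < n" "x = h i" "y = h j" by auto
      with xy show "(x, y) \<in> (\<lambda>(i, j). (h i, h j)) ` F" unfolding F_def by force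
    qed
    moreover have finF: "finite F" unfolding F_def
      by (rule finite_subset[of _ "{..<n} \<times> {..<n}"]) auto
    ultimately have EF: "card E \<le> card F" by (rule surj_card_le[rotated])
    have avoidF: "\<not> contains_pattern k \<rho> \<pi> F"
    proof
      assume "contains_pattern k \<rho> \<pi> F"
      then have "contains_pattern k \<rho> \<pi> E"
      proof (rule contains_patternE)
        fix x y
        assume xy: "\<And>i. i < k \<Longrightarrow> (x i, y i) \<in> F"
          "\<And>i j. i < k \<Longrightarrow> j < k \<Longrightarrow> \<rho> i < \<rho> j \<Longrightarrow> x i < x j"
          "\<And>i j. i < k \<Longrightarrow> j < k \<Longrightarrow> \<pi> i < \<pi> j \<Longrightarrow> y i < y j"
        show ?thesis
      proof (rule contains_patternI)
        show "(h (x i), h (y i)) \<in> E" if "i < k" for i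
          using xy(1)[OF that] unfolding F_def by simp
        show "h (x i) < h (x j)" if "i < k" "j < k" "\<rho> i < \<rho> j" for i j
          using xy(1)[OF that(2)] xy(2)[OF that] mono unfolding F_def by simp
        show "h (y i) < h (y j)" if "i < k" "j < k" "\<pi> i < \<pi> j" for i j
          using xy(1)[OF that(2)] xy(3)[OF that] mono unfolding F_def by simp
        qed
      qed
      with avoid show False ..
    qed
    have "s \<ge> 2" using k unfolding s_def by (simp add: Suc_le_eq)
    then obtain p where p: "s ^ p \<le> n" "n < s ^ (p + 1)"
      using ex_power_ivl1[OF _ n] by blast
    have "F \<subseteq> {..<s ^ (p + 1)} \<times> {..<s ^ (p + 1)}" unfolding F_def using p by auto
    then have "card F \<le> c * s ^ (p + 1)"
      unfolding c_def s_def using marcus_tardos_power[OF k _ avoidF] rk by blast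
    also have "\<dots> = c * s * s ^ p" by simp
    also have "\<dots> \<le> c * s * n" using p by (intro mult_le_mono) auto
    finally show ?thesis using EF unfolding n_def by linarith
  qed
  then show ?thesis by blast
qed

subsection \<open>Cliques in hereditarily sparse graphs\<close>

text \<open>The complete graph on \<open>W\<close>. Orienting edges upwards lets a graph double as a
  set of points for the pattern theorem.\<close>

definition ordered_pairs :: "nat set \<Rightarrow> (nat \<times> nat) set" where
  "ordered_pairs W = {(a, b). a \<in> W \<and> b \<in> W \<and> a < b}"

lemma ordered_pairs_mono: "V \<subseteq> W \<Longrightarrow> ordered_pairs V \<subseteq> ordered_pairs W"
  unfolding ordered_pairs_def by auto

lemma finite_ordered_pairs: "finite W \<Longrightarrow> finite (ordered_pairs W)"
  by (rule finite_subset[of _ "W \<times> W"]) (auto simp: ordered_pairs_def)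

text \<open>The binomial coefficient of \<open>card W\<close> over 2, written without subtraction or
  division. The induction adds a new largest vertex, which is the upper end of all new
  edges.\<close>

lemma card_ordered_pairs:
  assumes "finite W"
  shows "2 * card (ordered_pairs W) + card W = card W * card W"
  using assms
proof (induction W rule: finite_linorder_max_induct)
  case empty
  then show ?case by (simp add: ordered_pairs_def)
next
  case (insert b A)
  have b: "b \<notin> A" using insert by auto
  have "ordered_pairs (insert b A) = ordered_pairs A \<union> (\<lambda>a. (a, b)) ` A"
    unfolding ordered_pairs_def using insert by auto
  also have "card \<dots> = card (ordered_pairs A) + card ((\<lambda>a. (a, b)) ` A)"
    using insert b finite_ordered_pairs by (intro card_Un_disjoint) (auto simp: ordered_pairs_def)
  also have "card ((\<lambda>a. (a, b)) ` A) = card A" by (intro card_image) (auto simp: inj_on_def)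
  finally show ?case using insert b by (simp add: algebra_simps)
qed

text \<open>A clique on w vertices has w(w-1)/2 edges, while sparsity allows only cw.\<close>

lemma card_clique_le:
  assumes "finite W" "ordered_pairs W \<subseteq> G" "card (G \<inter> ordered_pairs W) \<le> c * card W"
  shows "card W \<le> 2 * c + 1"
proof (cases "card W = 0")
  case False
  have "G \<inter> ordered_pairs W = ordered_pairs W" using assms by auto
  then have "card W * card W \<le> (2 * c + 1) * card W"
    using assms card_ordered_pairs[of W] by (simp add: algebra_simps)
  then show ?thesis using False by (metis gr0I mult_le_cancel2)
qed simp

text \<open>The hypothesis makes \<open>G\<close> \<open>2c\<close>-degenerate.\<close>

lemma card_cliques_le:
  assumes "finite V" "\<And>W. W \<subseteq> V \<Longrightarrow> card (G \<inter> ordered_pairs W) \<le> c * card W"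
  shows "card {W. W \<subseteq> V \<and> W \<noteq> {} \<and> ordered_pairs W \<subseteq> G} \<le> card V * 2 ^ (2 * c)"
  using assms
proof (induction "card V" arbitrary: V)
  case 0
  then have "V = {}" by simp
  then have "{W. W \<subseteq> V \<and> W \<noteq> {} \<and> ordered_pairs W \<subseteq> G} = {}" by auto
  then show ?case by (simp only: card.empty le0)
next
  case (Suc n)
  define E where "E = G \<inter> ordered_pairs V"
  define N where "N v = {u \<in> V. (u, v) \<in> E \<or> (v, u) \<in> E}" for v
  have finE: "finite E" unfolding E_def using finite_ordered_pairs Suc by simp
  have fst_E: "fst ` E \<subseteq> V" and snd_E: "snd ` E \<subseteq> V"
    unfolding E_def ordered_pairs_def by auto
  \<comment> \<open>Every edge contributes to two degrees, so the degrees sum to at most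
    \<open>2 * c * card V\<close> and cannot all exceed \<open>2 * c\<close>.\<close>
  have "\<exists>v\<in>V. card (N v) \<le> 2 * c"
  proof (rule ccontr)
    assume "\<not> ?thesis"
    then have "2 * c + 1 \<le> card (N v)" if "v \<in> V" for v using that by force
    then have "of_nat (card V) * (2 * c + 1) \<le> (\<Sum>v\<in>V. card (N v))"
      by (intro sum_bounded_below) auto
    also have "\<dots> \<le> (\<Sum>v\<in>V. card {e \<in> E. snd e = v} + card {e \<in> E. fst e = v})"
    proof (intro sum_mono)
      fix v assume "v \<in> V"
      have "N v \<subseteq> fst ` {e \<in> E. snd e = v} \<union> snd ` {e \<in> E. fst e = v}"
        unfolding N_def by force
      then have "card (N v) \<le> card (fst ` {e \<in> E. snd e = v} \<union> snd ` {e \<in> E. fst e = v})"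
        using finE by (intro card_mono) auto
      also have "\<dots> \<le> card (fst ` {e \<in> E. snd e = v}) + card (snd ` {e \<in> E. fst e = v})"
        by (rule card_Un_le)
      also have "\<dots> \<le> card {e \<in> E. snd e = v} + card {e \<in> E. fst e = v}"
        using finE by (intro add_mono card_image_le) auto
      finally show "card (N v) \<le> card {e \<in> E. snd e = v} + card {e \<in> E. fst e = v}" .
    qed
    also have "\<dots> = (\<Sum>v\<in>V. card {e \<in> E. snd e = v}) + (\<Sum>v\<in>V. card {e \<in> E. fst e = v})"
      by (rule sum.distrib)
    also have "(\<Sum>v\<in>V. card {e \<in> E. snd e = v}) = card E"
      using sum.group[OF finE Suc(3) snd_E, of "\<lambda>_. 1::nat"] by simp
    also have "(\<Sum>v\<in>V. card {e \<in> E. fst e = v}) = card E"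
      using sum.group[OF finE Suc(3) fst_E, of "\<lambda>_. 1::nat"] by simp
    also have "card E + card E \<le> card V * (2 * c)"
    proof -
      have "card E \<le> c * card V" using Suc(4)[of V] unfolding E_def by simp
      then have "card E + card E \<le> 2 * (c * card V)" by linarith
      then show ?thesis by (simp add: ac_simps)
    qed
    finally show False using Suc(2) by simp
  qed
  then obtain v where v: "v \<in> V" and N: "card (N v) \<le> 2 * c" by blast
  let ?C = "\<lambda>V. {W. W \<subseteq> V \<and> W \<noteq> {} \<and> ordered_pairs W \<subseteq> G}"
  have cV: "card (V - {v}) = n" using v Suc by simp
  have IH: "card (?C (V - {v})) \<le> n * 2 ^ (2 * c)"
    using Suc(1)[of "V - {v}"] cV Suc(3,4) by (simp add: subset_Diff_insert)
  \<comment> \<open>Cliques avoiding \<open>v\<close> are left to the induction; a clique through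
    \<open>v\<close> is determined by its other members, which are neighbours of
    \<open>v\<close>.\<close>
  have sub: "?C V \<subseteq> ?C (V - {v}) \<union> insert v ` Pow (N v)"
  proof
    fix W assume W: "W \<in> ?C V"
    show "W \<in> ?C (V - {v}) \<union> insert v ` Pow (N v)"
    proof (cases "v \<in> W")
      case True
      have "u \<in> N v" if "u \<in> W - {v}" for u
      proof -
        have "(u, v) \<in> ordered_pairs W \<or> (v, u) \<in> ordered_pairs W"
          using that True unfolding ordered_pairs_def by auto
        then show ?thesis
          using W that ordered_pairs_mono[of W V] unfolding N_def E_def by auto
      qed
      then have "W - {v} \<in> Pow (N v)" by auto
      moreover have "W = insert v (W - {v})" using True by auto
      ultimately show ?thesis by blast
    qed (use W in auto)
  qed
  have finN: "finite (N v)" unfolding N_def using Suc(3) by simp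
  have "card (?C V) \<le> card (?C (V - {v}) \<union> insert v ` Pow (N v))"
    using sub finN Suc(3) by (intro card_mono) auto
  also have "\<dots> \<le> card (?C (V - {v})) + card (insert v ` Pow (N v))" by (rule card_Un_le)
  also have "card (insert v ` Pow (N v)) \<le> card (Pow (N v))"
    using finN by (intro card_image_le) auto
  also have "card (Pow (N v)) = 2 ^ card (N v)" by (rule card_Pow[OF finN])
  also have "2 ^ card (N v) \<le> (2::nat) ^ (2 * c)" using N by (intro power_increasing) auto
  finally have "card (?C V) \<le> Suc n * 2 ^ (2 * c)" using IH by simp
  then show ?case using Suc(2) by simp
qed

subsection \<open>Families of sets of large total size\<close>

text \<open>Greedy choice: a new index joins \<open>J\<close> exactly when its set has an element
  that does not yet represent another index. Representatives are never withdrawn, so a set once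
  covered by them stays covered.\<close>

lemma maximal_partial_representatives:
  assumes "finite T"
  shows "\<exists>J\<subseteq>T. \<exists>f. inj_on f J \<and> (\<forall>t\<in>J. f t \<in> B t) \<and> (\<forall>t\<in>T - J. B t \<subseteq> f ` J)"
  using assms
proof (induction T rule: finite_induct)
  case empty
  then show ?case by auto
next
  case (insert t T)
  then obtain J f where J: "J \<subseteq> T" "inj_on f J" "\<forall>t\<in>J. f t \<in> B t" "\<forall>t\<in>T - J. B t \<subseteq> f ` J"
    by blast
  show ?case
  proof (cases "B t \<subseteq> f ` J")
    case True
    then show ?thesis using J by (intro exI[of _ J] conjI exI[of _ f]) auto
  next
    case False
    then obtain b where b: "b \<in> B t" "b \<notin> f ` J" by auto
    have t: "t \<notin> J" using J insert by auto
    have "f ` J = (f(t := b)) ` J" using t by (intro image_cong) auto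
    then have sub: "f ` J \<subseteq> (f(t := b)) ` insert t J" by blast
    have "inj_on (f(t := b)) (insert t J)"
      using J(2) b t by (auto simp: inj_on_def)
    moreover have "\<forall>u\<in>insert t J. (f(t := b)) u \<in> B u" using J b t by auto
    moreover have "\<forall>u\<in>insert t T - insert t J. B u \<subseteq> (f(t := b)) ` insert t J"
      using J(4) sub by blast
    moreover have "insert t J \<subseteq> insert t T" using J by auto
    ultimately show ?thesis by blast
  qed
qed

section \<open>Pieces of consecutive elements\<close>

text \<open>Elements are grouped by their rank in \<open>S\<close>. The group of index
  \<open>card S div L\<close> is the remainder and may be shorter than \<open>L\<close>.\<close>

definition piece :: "nat \<Rightarrow> nat set \<Rightarrow> nat \<Rightarrow> nat set" where
  "piece L S q = enumerate S ` {j. j < card S \<and> j div L = q}"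

lemma piece_subset: "finite S \<Longrightarrow> piece L S q \<subseteq> S"
  unfolding piece_def by (auto intro: finite_enumerate_in_set)

lemma piece_less:
  assumes "finite S" "q < q'" "a \<in> piece L S q" "b \<in> piece L S q'"
  shows "a < b"
proof -
  obtain i j where ij: "a = enumerate S i" "b = enumerate S j" "j < card S" "i div L < j div L"
    using assms unfolding piece_def by auto
  have "i < j" using ij(4) div_le_mono[of j i L] by linarith
  then show ?thesis using ij finite_enumerate_mono[OF _ assms(1)] by simp
qed

lemma card_piece:
  assumes "finite S" "L > 0" "q < card S div L"
  shows "card (piece L S q) = L"
proof -
  have "(q + 1) * L \<le> card S div L * L" using assms(3) by (intro mult_le_mono1) simp
  also have "\<dots> \<le> card S" by simp
  finally have le: "(q + 1) * L \<le> card S" .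
  have div: "j div L = q \<longleftrightarrow> q * L \<le> j \<and> j < (q + 1) * L" for j
    using less_eq_div_iff_mult_less_eq[OF assms(2), of q j]
      div_less_iff_less_mult[OF assms(2), of j "q + 1"] by linarith
  have "{j. j < card S \<and> j div L = q} = {q * L..<(q + 1) * L}"
    unfolding div using less_le_trans[OF _ le] by auto
  moreover have "inj_on (enumerate S) {q * L..<(q + 1) * L}"
  proof (rule inj_on_subset)
    show "inj_on (enumerate S) {..<card S}"
      using finite_bij_enumerate[OF assms(1)] by (rule bij_betw_imp_inj_on)
    show "{q * L..<(q + 1) * L} \<subseteq> {..<card S}" using less_le_trans[OF _ le] by auto
  qed
  ultimately show ?thesis unfolding piece_def by (simp add: card_image)
qed

lemma piece_whole:
  assumes "finite S" "card S < L"
  shows "piece L S 0 = S"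
proof -
  have "{j. j < card S \<and> j div L = 0} = {..<card S}" using assms by auto
  then show ?thesis
    unfolding piece_def using finite_bij_enumerate[OF assms(1)] by (simp add: bij_betw_def)
qed

lemma contains_pattern_mono:
  assumes "contains_pattern k \<rho> \<pi> E" "E \<subseteq> F"
  shows "contains_pattern k \<rho> \<pi> F"
  using assms(1)
proof (rule contains_patternE)
  fix x y
  assume xy: "\<And>i. i < k \<Longrightarrow> (x i, y i) \<in> E"
    and *: "\<And>i j. i < k \<Longrightarrow> j < k \<Longrightarrow> \<rho> i < \<rho> j \<Longrightarrow> x i < x j"
      "\<And>i j. i < k \<Longrightarrow> j < k \<Longrightarrow> \<pi> i < \<pi> j \<Longrightarrow> y i < y j"
  have "(x i, y i) \<in> F" if "i < k" for i using xy[OF that] assms(2) by blast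
  then show ?thesis using * by (rule contains_patternI)
qed

text \<open>The combinatorial form of the matrix theorem, with \<open>S r\<close> the set of ones in
  row \<open>r\<close>. The rankings \<open>\<kappa>\<close> and \<open>\<mu>\<close> encode the two
  permutation matrices, and \<open>x i < y j\<close> for all \<open>i\<close> and \<open>j\<close>
  puts the columns of the left matrix before those of the right one.\<close>

theorem heavy_family_of_sets_pattern:
  fixes k :: nat
  shows "\<exists>C. \<forall>\<kappa> \<mu> (I :: 'r set) S n. inj_on \<kappa> {..<k} \<longrightarrow> (\<forall>i<k. \<kappa> i < k \<and> \<mu> i < k) \<longrightarrow> finite I \<longrightarrow> inj_on S I \<longrightarrow> (\<forall>r\<in>I. S r \<subseteq> {..<n}) \<longrightarrow> n \<ge> 1 \<longrightarrow>
    C * n \<le> (\<Sum>r\<in>I. card (S r)) \<longrightarrow>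
    (\<exists>r x y. inj_on r {..<k} \<and> (\<forall>i<k. r i \<in> I \<and> x i \<in> S (r i) \<and> y i \<in> S (r i)) \<and>
      (\<forall>i<k. \<forall>j<k. x i < y j) \<and> (\<forall>i<k. \<forall>j<k. \<kappa> i < \<kappa> j \<longrightarrow> x i < x j) \<and>
      (\<forall>i<k. \<forall>j<k. \<mu> i < \<mu> j \<longrightarrow> y i < y j))"
proof -
  obtain c where c: "\<And>\<rho> \<pi> W E. \<forall>i<Suc k. \<rho> i < Suc k \<and> \<pi> i < Suc k \<Longrightarrow> finite W \<Longrightarrow>
      E \<subseteq> W \<times> W \<Longrightarrow> \<not> contains_pattern (Suc k) \<rho> \<pi> E \<Longrightarrow> card E \<le> c * card W"
  proof -
    have "1 \<le> Suc k" by simp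
    from marcus_tardos[OF this] show thesis by (elim exE) (rule that, blast)
  qed
  \<comment> \<open>One more than the largest size of a clique permitted by
    \<open>card_clique_le\<close>, so a full piece is never a clique.\<close>
  define L where "L = 2 * c + 2"
  \<comment> \<open>Each piece accounts for at most \<open>2 * L\<close> ones. The summands in the
    bracket count represented pieces, a possible empty row and nonempty cliques; the final 1 makes
    the concluding inequality strict.\<close>
  define C where "C = 2 * L * (c + 1 + 2 ^ (2 * c)) + 1"
  have L: "L > 0" unfolding L_def by simp
  have main: "\<exists>r x y. inj_on r {..<k} \<and> (\<forall>i<k. r i \<in> I \<and> x i \<in> S (r i) \<and> y i \<in> S (r i)) \<and>
      (\<forall>i<k. \<forall>j<k. x i < y j) \<and> (\<forall>i<k. \<forall>j<k. \<kappa> i < \<kappa> j \<longrightarrow> x i < x j) \<and>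
      (\<forall>i<k. \<forall>j<k. \<mu> i < \<mu> j \<longrightarrow> y i < y j)" (is ?pattern)
    if inj: "inj_on \<kappa> {..<k}" and rk: "\<forall>i<k. \<kappa> i < k \<and> \<mu> i < k"
      and I: "finite I" and injS: "inj_on S I" and S: "\<forall>r\<in>I. S r \<subseteq> {..<n}" and n: "n \<ge> 1"
      and heavy: "C * n \<le> (\<Sum>r\<in>I. card (S r))" for \<kappa> \<mu> and I :: "'r set" and S n
  proof (rule ccontr)
    assume none: "\<not> ?pattern"
    \<comment> \<open>The extra point \<open>k\<close> lies to the right of all other \<open>x i\<close> and to the left of all other \<open>y i\<close>.\<close>
    define \<rho> where "\<rho> i = (if i = k then k else \<kappa> i)" for i
    define \<pi> where "\<pi> i = (if i = k then 0 else Suc (\<mu> i))" for i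
    have rk': "\<forall>i<Suc k. \<rho> i < Suc k \<and> \<pi> i < Suc k"
    proof (intro allI impI)
      fix i assume "i < Suc k"
      then show "\<rho> i < Suc k \<and> \<pi> i < Suc k"
        using rk[rule_format, of i] unfolding \<rho>_def \<pi>_def by (cases "i = k") simp_all
    qed
    have finS: "finite (S r)" if "r \<in> I" for r
      using S that finite_subset[OF _ finite_lessThan] by blast
    \<comment> \<open>A row with at least \<open>L\<close> elements keeps only its full pieces and
      loses the remainder; the maximum with 1 gives every shorter row, even an empty one, a single
      piece.\<close>
    define m where "m r = max 1 (card (S r) div L)" for r
    define T where "T = (SIGMA r:I. {..<m r})"
    define P where "P = (\<lambda>(r, q). piece L (S r) q)"
    have finT: "finite T" unfolding T_def using I by simp
    have PS: "P t \<subseteq> S (fst t)" "fst t \<in> I" if "t \<in> T" for t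
      using that piece_subset[OF finS, of "fst t" L "snd t"] unfolding T_def P_def by auto
    obtain J f where J: "J \<subseteq> T" and injf: "inj_on f J"
      and f: "\<forall>t\<in>J. f t \<in> ordered_pairs (P t)"
      and clique: "\<forall>t\<in>T - J. ordered_pairs (P t) \<subseteq> f ` J"
      using maximal_partial_representatives[OF finT, of "\<lambda>t. ordered_pairs (P t)"] by blast
    define G where "G = f ` J"
    have avoid: "\<not> contains_pattern (Suc k) \<rho> \<pi> G"
    proof
      assume "contains_pattern (Suc k) \<rho> \<pi> G"
      then show False
      proof (rule contains_patternE)
        fix x y
        assume G: "\<And>i. i < Suc k \<Longrightarrow> (x i, y i) \<in> G"
          and x: "\<And>i j. i < Suc k \<Longrightarrow> j < Suc k \<Longrightarrow> \<rho> i < \<rho> j \<Longrightarrow> x i < x j"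
          and y: "\<And>i j. i < Suc k \<Longrightarrow> j < Suc k \<Longrightarrow> \<pi> i < \<pi> j \<Longrightarrow> y i < y j"
        have "\<exists>t. i < Suc k \<longrightarrow> t \<in> J \<and> f t = (x i, y i)" for i
          using G[of i] unfolding G_def by (metis imageE)
        then obtain t where t: "\<And>i. i < Suc k \<Longrightarrow> t i \<in> J" "\<And>i. i < Suc k \<Longrightarrow> f (t i) = (x i, y i)"
          by metis
        have xy: "x i \<in> P (t i) \<and> y i \<in> P (t i) \<and> x i < y i" if "i < Suc k" for i
        proof -
          have "(x i, y i) \<in> ordered_pairs (P (t i))" using f t[OF that] by metis
          then show ?thesis unfolding ordered_pairs_def by simp
        qed
        have xmono: "x i < x j" if "i < k" "j < k" "\<kappa> i < \<kappa> j" for i j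
          using that x[of i j] unfolding \<rho>_def by simp
        have ymono: "y i < y j" if "i < k" "j < k" "\<mu> i < \<mu> j" for i j
          using that y[of i j] unfolding \<pi>_def by simp
        have overlap: "x i < y j" if "i < k" "j < k" for i j
        proof -
          have "x i < x k" using that rk x[of i k] unfolding \<rho>_def by simp
          also have "x k < y k" using xy[of k] by simp
          also have "y k < y j" using that y[of k j] unfolding \<pi>_def by simp
          finally show ?thesis .
        qed
        \<comment> \<open>Within one row, a piece of smaller index lies entirely to the left, giving
          \<open>y i < x j\<close>; \<open>overlap\<close> with exchanged indices says the
          opposite.\<close>
        have no_left: "\<not> snd (t i) < snd (t j)" if "i < k" "j < k" "fst (t i) = fst (t j)" for i j
        proof
          assume less: "snd (t i) < snd (t j)"
          have "y i \<in> piece L (S (fst (t i))) (snd (t i))"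
            "x j \<in> piece L (S (fst (t i))) (snd (t j))"
            using xy[of i] xy[of j] that unfolding P_def by (simp_all add: case_prod_beta)
          moreover have "finite (S (fst (t i)))"
            by (rule finS, rule PS(2)) (use that t(1)[of i] J in auto)
          ultimately have "y i < x j" using piece_less less by blast
          with overlap[OF that(2,1)] show False by simp
        qed
        \<comment> \<open>Equal rows force equal pieces, hence the same representative and
          \<open>x i = x j\<close>. Different values of \<open>\<kappa>\<close> would separate
          these, so injectivity of \<open>\<kappa>\<close> yields \<open>i = j\<close>.\<close>
        have "inj_on (\<lambda>i. fst (t i)) {..<k}"
        proof (rule inj_onI)
          fix i j assume ij: "i \<in> {..<k}" "j \<in> {..<k}" "fst (t i) = fst (t j)"
          have "snd (t i) = snd (t j)"
            using no_left[of i j] no_left[of j i] ij by simp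
          with ij(3) have "t i = t j" by (rule prod_eqI)
          then have "x i = x j" using t(2)[of i] t(2)[of j] ij by simp
          then have "\<kappa> i = \<kappa> j"
            using xmono[of i j] xmono[of j i] ij by (cases "\<kappa> i" "\<kappa> j" rule: linorder_cases) auto
          with inj ij show "i = j" by (auto dest: inj_onD)
        qed
        moreover have "fst (t i) \<in> I \<and> x i \<in> S (fst (t i)) \<and> y i \<in> S (fst (t i))" if "i < k" for i
        proof -
          have "t i \<in> T" using that t(1)[of i] J by auto
          then show ?thesis using that xy[of i] PS[of "t i"] by auto
        qed
        ultimately have ?pattern
          using overlap xmono ymono
          by (intro exI[of _ "\<lambda>i. fst (t i)"] exI[of _ x] exI[of _ y]) simp
        with none show False ..
      qed
    qed
    \<comment> \<open>Avoiding a pattern is inherited by subgraphs, so the edge bound holds on every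
      vertex set, as both clique lemmas require.\<close>
    have G_le: "card (G \<inter> ordered_pairs W) \<le> c * card W" if "W \<subseteq> {..<n}" for W
    proof (rule c[OF rk'])
      show "finite W" using finite_subset[OF that finite_lessThan] .
      show "G \<inter> ordered_pairs W \<subseteq> W \<times> W" unfolding ordered_pairs_def by auto
      show "\<not> contains_pattern (Suc k) \<rho> \<pi> (G \<inter> ordered_pairs W)"
        using avoid contains_pattern_mono[of _ _ _ "G \<inter> ordered_pairs W" G] by auto
    qed
    have "G \<subseteq> ordered_pairs {..<n}"
    proof
      fix e assume "e \<in> G"
      then obtain t where t: "t \<in> J" "e \<in> ordered_pairs (P t)" using f unfolding G_def by auto
      then have "P t \<subseteq> {..<n}" using PS[of t] J S by blast
      then show "e \<in> ordered_pairs {..<n}" using t ordered_pairs_mono by blast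
    qed
    then have "G \<inter> ordered_pairs {..<n} = G" by auto
    then have "card G \<le> c * n" using G_le[of "{..<n}"] by simp
    then have cJ: "card J \<le> c * n" unfolding G_def by (simp add: card_image injf)
    have unrep: "snd t = 0 \<and> S (fst t) \<subseteq> {..<n} \<and> ordered_pairs (S (fst t)) \<subseteq> G" if t: "t \<in> T - J" for t
    proof -
      obtain r q where rq: "t = (r, q)" by force
      have r: "r \<in> I" "q < m r" using t unfolding rq T_def by auto
      have Pt: "P t \<subseteq> {..<n}" using PS[of t] t S by blast
      have G: "ordered_pairs (P t) \<subseteq> G" using clique t unfolding G_def by blast
      have "card (P t) \<le> 2 * c + 1"
        by (rule card_clique_le[OF _ G G_le[OF Pt]]) (rule finite_subset[OF Pt finite_lessThan])
      then have "card (piece L (S r) q) \<noteq> L" unfolding P_def rq L_def by simp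
      then have "\<not> q < card (S r) div L" using card_piece[OF finS[OF r(1)] L] by blast
      \<comment> \<open>The index \<open>q\<close> is below the maximum of 1 and the quotient but
        not below the quotient, so the quotient is 0 and the row is short.\<close>
      then have "card (S r) div L = 0 \<and> q = 0" using r(2) unfolding m_def by auto
      moreover from this have "card (S r) < L" using L by (simp add: div_eq_0_iff)
      ultimately have "P t = S r" "q = 0"
        using piece_whole[OF finS[OF r(1)]] unfolding P_def rq by auto
      then show ?thesis using Pt G unfolding rq by simp
    qed
    let ?K = "{W. W \<subseteq> {..<n} \<and> W \<noteq> {} \<and> ordered_pairs W \<subseteq> G}"
    have finK: "finite ?K" by (rule finite_subset[of _ "Pow {..<n}"]) auto
    \<comment> \<open>Distinctness of the rows enters here: unrepresented pieces are entire rows, so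
      different ones are different cliques.\<close>
    have "inj_on (\<lambda>t. S (fst t)) (T - J)"
    proof (rule inj_onI)
      fix t u assume tu: "t \<in> T - J" "u \<in> T - J" "S (fst t) = S (fst u)"
      then have "fst t = fst u" using inj_onD[OF injS tu(3) PS(2) PS(2)] by simp
      moreover have "snd t = snd u" using unrep tu by metis
      ultimately show "t = u" by (rule prod_eqI)
    qed
    \<comment> \<open>The clique count omits the empty set, which has to be added since one row may
      be empty.\<close>
    moreover have "(\<lambda>t. S (fst t)) ` (T - J) \<subseteq> insert {} ?K" using unrep by auto
    ultimately have "card (T - J) \<le> card (insert {} ?K)"
      using finK by (intro card_inj_on_le) auto
    also have "\<dots> \<le> Suc (card ?K)" by (simp add: card_insert_if finK)
    also have "card ?K \<le> card {..<n} * 2 ^ (2 * c)"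
      by (rule card_cliques_le) (use G_le in auto)
    finally have cT_J: "card (T - J) \<le> 1 + n * 2 ^ (2 * c)" by simp
    have "card T = card J + card (T - J)"
      using J finT by (metis card_Diff_subset card_mono finite_subset le_add_diff_inverse)
    also have "\<dots> \<le> c * n + (n + n * 2 ^ (2 * c))" using cJ cT_J n by linarith
    also have "\<dots> = (c + 1 + 2 ^ (2 * c)) * n" by (simp add: algebra_simps)
    finally have cT: "card T \<le> (c + 1 + 2 ^ (2 * c)) * n" .
    have "(\<Sum>r\<in>I. card (S r)) \<le> (\<Sum>r\<in>I. 2 * L * m r)"
    proof (rule sum_mono)
      fix r
      \<comment> \<open>The lost remainder is shorter than \<open>L\<close>, hence than
        \<open>L * m r\<close>, so dropping it costs at most a factor 2.\<close>
      have "card (S r) \<le> L * (card (S r) div L) + L"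
        using mult_div_mod_eq[of L "card (S r)"] mod_less_divisor[OF L, of "card (S r)"] by linarith
      also have "\<dots> \<le> L * m r + L * m r"
        unfolding m_def by (intro add_mono mult_le_mono2) auto
      finally show "card (S r) \<le> 2 * L * m r" by simp
    qed
    also have "\<dots> = 2 * L * card T"
      unfolding T_def using I by (simp add: sum_distrib_left)
    also have "\<dots> \<le> 2 * L * ((c + 1 + 2 ^ (2 * c)) * n)" by (rule mult_le_mono2[OF cT])
    also have "\<dots> < C * n"
    proof -
      have "C * n = 2 * L * ((c + 1 + 2 ^ (2 * c)) * n) + n"
        unfolding C_def by (simp add: algebra_simps)
      then show ?thesis using n by linarith
    qed
    finally show False using heavy by simp
  qed
  show ?thesis by (rule exI[of _ C]) (intro allI impI, rule main)
qed

subsection \<open>Matrices\<close>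

text \<open>Exactly \<open>j\<close> elements of the image lie below \<open>h j\<close>, and
  \<open>pick\<close> returns the element of a given rank. The columns of a submatrix can thus be
  prescribed by an increasing function.\<close>

lemma pick_strict_mono_image:
  assumes mono: "\<And>i j. i < j \<Longrightarrow> j < N \<Longrightarrow> h i < h j" and j: "j < N"
  shows "pick (h ` {..<N}) j = h j"
proof -
  have less: "h i < h j \<longleftrightarrow> i < j" if "i < N" for i
    using mono[of i j] mono[of j i] that j by (cases i j rule: linorder_cases) auto
  have "{a \<in> h ` {..<N}. a < h j} = h ` {..<j}"
    using less j by auto
  moreover have "inj_on h {..<j}"
  proof (rule inj_onI)
    fix a b assume "a \<in> {..<j}" "b \<in> {..<j}" "h a = h b"
    then show "a = b"
      using mono[of a b] mono[of b a] j by (cases a b rule: linorder_cases) auto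
  qed
  ultimately have "card {a \<in> h ` {..<N}. a < h j} = j" by (simp add: card_image)
  then show ?thesis using pick_card_in_set[of "h j" "h ` {..<N}"] j by simp
qed

section \<open>Permutation matrices and permutations of rows\<close>

text \<open>Uniqueness in rows yields the function \<open>\<kappa>\<close>, uniqueness in columns
  its injectivity, and an injective self-map of a finite set is bijective.\<close>

lemma permutation_matE:
  assumes "permutation_mat k K"
  obtains \<kappa> where "bij_betw \<kappa> {..<k} {..<k}"
    and "\<And>i j. i < k \<Longrightarrow> j < k \<Longrightarrow> K $$ (i, j) = 1 \<longleftrightarrow> j = \<kappa> i"
proof -
  have row: "\<forall>i<k. \<exists>!j. j < k \<and> K $$ (i, j) = 1" and col: "\<forall>j<k. \<exists>!i. i < k \<and> K $$ (i, j) = 1"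
    using assms unfolding permutation_mat_def by auto
  define \<kappa> where "\<kappa> i = (THE j. j < k \<and> K $$ (i, j) = 1)" for i
  have \<kappa>: "\<kappa> i < k \<and> K $$ (i, \<kappa> i) = 1" if "i < k" for i
    unfolding \<kappa>_def by (rule theI') (use row that in simp)
  have eq: "K $$ (i, j) = 1 \<longleftrightarrow> j = \<kappa> i" if "i < k" "j < k" for i j
    using row \<kappa>[OF that(1)] that by blast
  have "inj_on \<kappa> {..<k}"
  proof (rule inj_onI)
    fix i i' assume i: "i \<in> {..<k}" "i' \<in> {..<k}" "\<kappa> i = \<kappa> i'"
    then have "K $$ (i, \<kappa> i) = 1" "K $$ (i', \<kappa> i) = 1" "\<kappa> i < k"
      using \<kappa>[of i] \<kappa>[of i'] by simp_all
    then show "i = i'" using col i by blast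
  qed
  moreover have "\<kappa> ` {..<k} \<subseteq> {..<k}" using \<kappa> by auto
  ultimately have "bij_betw \<kappa> {..<k} {..<k}"
    by (simp add: bij_betw_def endo_inj_surj)
  then show thesis using eq by (rule that)
qed

lemma permutation_mat_permute_rows:
  assumes K: "permutation_mat k K" and p: "p permutes {..<k}"
  shows "permutation_mat k (permute_mat_rows p K)"
proof -
  have dim: "dim_row K = k" "dim_col K = k"
    using K unfolding permutation_mat_def by auto
  have row: "\<forall>i<k. \<exists>!j. j < k \<and> K $$ (i, j) = 1" and col: "\<forall>j<k. \<exists>!i. i < k \<and> K $$ (i, j) = 1"
    using K unfolding permutation_mat_def by auto
  have entry: "permute_mat_rows p K $$ (i, j) = K $$ (p i, j)" if "i < k" "j < k" for i j
    using that dim unfolding permute_mat_rows_def by simp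
  have pk: "p i < k \<longleftrightarrow> i < k" for i using permutes_in_image[OF p, of i] by simp
  have "elements_mat (permute_mat_rows p K) \<subseteq> elements_mat K"
  proof
    fix a assume "a \<in> elements_mat (permute_mat_rows p K)"
    then obtain i j where ij: "i < k" "j < k" "a = permute_mat_rows p K $$ (i, j)"
      unfolding elements_mat_def by (auto simp: dim)
    then show "a \<in> elements_mat K"
      using pk[of i] dim by (intro elements_matI[of K k k "p i" j]) (auto simp: entry)
  qed
  also have "elements_mat K \<subseteq> {0, 1}"
    using K unfolding permutation_mat_def zero_one_mat_def by (elim conjE)
  finally have "zero_one_mat (permute_mat_rows p K)" unfolding zero_one_mat_def .
  moreover have "\<exists>!j. j < k \<and> permute_mat_rows p K $$ (i, j) = 1" if "i < k" for i
  proof -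
    have "\<exists>!j. j < k \<and> K $$ (p i, j) = 1" using row[rule_format, of "p i"] pk[of i] that by simp
    moreover have "(\<lambda>j. j < k \<and> K $$ (p i, j) = 1) = (\<lambda>j. j < k \<and> permute_mat_rows p K $$ (i, j) = 1)"
      using entry[OF that] by auto
    ultimately show ?thesis by simp
  qed
  moreover have "\<exists>!i. i < k \<and> permute_mat_rows p K $$ (i, j) = 1" if j: "j < k" for j
  proof -
    obtain i where i: "i < k" "K $$ (i, j) = 1"
      and uniq: "\<forall>i'. i' < k \<and> K $$ (i', j) = 1 \<longrightarrow> i' = i"
      using col[rule_format, OF j] by (elim ex1E conjE)
    obtain i' where i': "p i' = i" using permutes_surj[OF p] by (metis surjD)
    show ?thesis
    proof (rule ex1I[of _ i'])
      show "i' < k \<and> permute_mat_rows p K $$ (i', j) = 1"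
        using i i' pk[of i'] entry[of i' j] j by simp
      fix l assume l: "l < k \<and> permute_mat_rows p K $$ (l, j) = 1"
      then have "p l = i" using uniq[rule_format, of "p l"] pk[of l] entry[of l j] j by simp
      then show "l = i'" using i' permutes_inj[OF p] by (auto dest: injD)
    qed
  qed
  moreover have "permute_mat_rows p K \<in> carrier_mat k k"
    using dim by (intro carrier_matI) simp_all
  ultimately show ?thesis unfolding permutation_mat_def by blast
qed

lemma dim_append_cols:
  assumes "K \<in> carrier_mat k k" "L \<in> carrier_mat k k"
  shows "dim_row (append_cols K L) = k" "dim_col (append_cols K L) = 2 * k"
  using assms unfolding append_cols_def by auto

lemma index_append_cols:
  assumes "K \<in> carrier_mat k k" "L \<in> carrier_mat k k" "i < k" "j < 2 * k"
  shows "append_cols K L $$ (i, j) = (if j < k then K $$ (i, j) else L $$ (i, j - k))"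
  using assms unfolding append_cols_def by (auto simp: index_mat_four_block)

lemma permute_mat_rows_append_cols:
  assumes K: "K \<in> carrier_mat k k" and L: "L \<in> carrier_mat k k" and p: "p permutes {..<k}"
  shows "permute_mat_rows p (append_cols K L) =
    append_cols (permute_mat_rows p K) (permute_mat_rows p L)"
proof -
  have pk: "p i < k" if "i < k" for i using permutes_in_image[OF p, of i] that by simp
  have *: "permute_mat_rows p K \<in> carrier_mat k k" "permute_mat_rows p L \<in> carrier_mat k k"
    using K L by auto
  show ?thesis
  proof (rule eq_matI)
    fix i j
    assume "i < dim_row (append_cols (permute_mat_rows p K) (permute_mat_rows p L))"
      "j < dim_col (append_cols (permute_mat_rows p K) (permute_mat_rows p L))"
    then have ij: "i < k" "j < 2 * k" using dim_append_cols[OF *] by simp_all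
    have "permute_mat_rows p (append_cols K L) $$ (i, j) = append_cols K L $$ (p i, j)"
      using ij dim_append_cols[OF K L] unfolding permute_mat_rows_def by simp
    also have "\<dots> = append_cols (permute_mat_rows p K) (permute_mat_rows p L) $$ (i, j)"
      unfolding index_append_cols[OF K L pk[OF ij(1)] ij(2)] index_append_cols[OF * ij]
      using K L ij unfolding permute_mat_rows_def by auto
    finally show "permute_mat_rows p (append_cols K L) $$ (i, j) =
      append_cols (permute_mat_rows p K) (permute_mat_rows p L) $$ (i, j)" .
  qed (simp_all add: dim_append_cols[OF *] dim_append_cols[OF K L])
qed

section \<open>Rows as sets of ones\<close>

lemma num_ones_eq_sum:
  assumes "A \<in> carrier_mat m n"
  shows "num_ones A = (\<Sum>i<m. card {j. j < n \<and> A $$ (i, j) = 1})"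
proof -
  have "{(i, j). i < dim_row A \<and> j < dim_col A \<and> A $$ (i, j) = 1}
      = (SIGMA i:{..<m}. {j. j < n \<and> A $$ (i, j) = 1})"
    using assms by auto
  then show ?thesis unfolding num_ones_def by (simp add: card_SigmaI)
qed

text \<open>Entries off the support can only be 0, so a row can be recovered from its
  support.\<close>

lemma inj_on_row_supports:
  assumes A: "A \<in> carrier_mat m n" and zo: "zero_one_mat A" and d: "distinct (rows A)"
  shows "inj_on (\<lambda>i. {j. j < n \<and> A $$ (i, j) = 1}) {..<m}"
proof (rule inj_onI)
  fix i i' assume i: "i \<in> {..<m}" "i' \<in> {..<m}"
    and eq: "{j. j < n \<and> A $$ (i, j) = 1} = {j. j < n \<and> A $$ (i', j) = 1}"
  have zero_one: "A $$ (l, j) = 0 \<or> A $$ (l, j) = 1" if "l < m" "j < n" for l j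
    using elements_matI[OF A that refl] zo unfolding zero_one_mat_def by auto
  have "A $$ (i, j) = A $$ (i', j)" if "j < n" for j
  proof -
    have "A $$ (i, j) = 1 \<longleftrightarrow> A $$ (i', j) = 1"
      using arg_cong[OF eq, of "\<lambda>X. j \<in> X"] that by simp
    then show ?thesis using that zero_one[of i j] zero_one[of i' j] i by auto
  qed
  then have "row A i = row A i'"
    using A i by (intro eq_vecI) auto
  then have "rows A ! i = rows A ! i'" using A i by simp
  then show "i = i'" using nth_eq_iff_index_eq[OF d, of i i'] A i by simp
qed

text \<open>The set theorem provides rows in no particular order. Listing them increasingly permutes
  the rows of the chosen representative \<open>M\<close>, and the result \<open>Q\<close> is still
  in the class of \<open>M\<close>.\<close>

theorem theorem2:
  fixes k :: nat
  assumes "k \<ge> 1"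
  shows "\<exists>c :: real. \<forall>m n :: nat. \<forall>A :: nat mat.
    m \<ge> 1 \<longrightarrow> n \<ge> 1 \<longrightarrow> A \<in> carrier_mat m n \<longrightarrow> zero_one_mat A \<longrightarrow>
    c * real n \<le> real (num_ones A) \<longrightarrow> distinct (rows A) \<longrightarrow>
    (\<forall>\<C> \<in> perm_pair_classes k. \<exists>Q \<in> \<C>. mat_contains A Q)"
proof -
  obtain C where C: "\<And>\<kappa> \<mu> (I :: nat set) S n. inj_on \<kappa> {..<k} \<Longrightarrow> \<forall>i<k. \<kappa> i < k \<and> \<mu> i < k \<Longrightarrow>
      finite I \<Longrightarrow> inj_on S I \<Longrightarrow> \<forall>r\<in>I. S r \<subseteq> {..<n} \<Longrightarrow> n \<ge> 1 \<Longrightarrow>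
      C * n \<le> (\<Sum>r\<in>I. card (S r)) \<Longrightarrow>
      \<exists>r x y. inj_on r {..<k} \<and> (\<forall>i<k. r i \<in> I \<and> x i \<in> S (r i) \<and> y i \<in> S (r i)) \<and>
      (\<forall>i<k. \<forall>j<k. x i < y j) \<and> (\<forall>i<k. \<forall>j<k. \<kappa> i < \<kappa> j \<longrightarrow> x i < x j) \<and>
      (\<forall>i<k. \<forall>j<k. \<mu> i < \<mu> j \<longrightarrow> y i < y j)"
    by (rule exE[OF heavy_family_of_sets_pattern[of k]]) (rule that, blast)
  have main: "\<exists>Q\<in>\<C>. mat_contains A Q"
    if n: "n \<ge> 1" and A: "A \<in> carrier_mat m n" and zo: "zero_one_mat A"
      and heavy: "real C * real n \<le> real (num_ones A)" and d: "distinct (rows A)"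
      and \<C>: "\<C> \<in> perm_pair_classes k" for m n A \<C>
  proof -
    obtain M where M: "M \<in> perm_pair_mats k" and \<C>_eq: "\<C> = perm_pair_rel k `` {M}"
      using \<C> unfolding perm_pair_classes_def by (rule quotientE)
    obtain K L where KL: "permutation_mat k K" "permutation_mat k L" and M_eq: "M = append_cols K L"
      using M unfolding perm_pair_mats_def by blast
    have K: "K \<in> carrier_mat k k" and L: "L \<in> carrier_mat k k"
      using KL unfolding permutation_mat_def by auto
    obtain \<kappa> where \<kappa>: "bij_betw \<kappa> {..<k} {..<k}"
      and K_one: "\<And>i j. i < k \<Longrightarrow> j < k \<Longrightarrow> K $$ (i, j) = 1 \<longleftrightarrow> j = \<kappa> i"
      using permutation_matE[OF KL(1)] by metis
    obtain \<mu> where \<mu>: "bij_betw \<mu> {..<k} {..<k}"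
      and L_one: "\<And>i j. i < k \<Longrightarrow> j < k \<Longrightarrow> L $$ (i, j) = 1 \<longleftrightarrow> j = \<mu> i"
      using permutation_matE[OF KL(2)] by metis
    define S where "S i = {j. j < n \<and> A $$ (i, j) = 1}" for i
    have "real (C * n) \<le> real (num_ones A)" using heavy by simp
    then have "C * n \<le> num_ones A" by (simp only: of_nat_le_iff)
    then have sum: "C * n \<le> (\<Sum>i<m. card (S i))"
      unfolding S_def using num_ones_eq_sum[OF A] by simp
    have inj: "inj_on S {..<m}"
      unfolding S_def by (rule inj_on_row_supports[OF A zo d])
    have less: "\<forall>i<k. \<kappa> i < k \<and> \<mu> i < k"
      using \<kappa> \<mu> by (auto simp: bij_betw_def)
    have sub: "\<forall>r\<in>{..<m}. S r \<subseteq> {..<n}" unfolding S_def by auto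
    obtain r x y where r: "inj_on r {..<k}"
      and rxy: "\<forall>i<k. r i \<in> {..<m} \<and> x i \<in> S (r i) \<and> y i \<in> S (r i)"
      and xy: "\<forall>i<k. \<forall>j<k. x i < y j" and x: "\<forall>i<k. \<forall>j<k. \<kappa> i < \<kappa> j \<longrightarrow> x i < x j"
      and y: "\<forall>i<k. \<forall>j<k. \<mu> i < \<mu> j \<longrightarrow> y i < y j"
      using C[OF bij_betw_imp_inj_on[OF \<kappa>] less finite_lessThan inj sub n sum]
      by (elim exE conjE)
    define R where "R = r ` {..<k}"
    have cR: "card R = k" unfolding R_def using r by (simp add: card_image)
    have Rm: "R \<subseteq> {..<m}" unfolding R_def using rxy by auto
    \<comment> \<open>Row \<open>i\<close> of the submatrix is the \<open>i\<close>-th smallest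
      chosen row, and \<open>p i\<close> is the pattern point lying in it. The identity beyond
      \<open>k\<close> is what \<open>permutes\<close> demands.\<close>
    define p where "p i = (if i < k then the_inv_into {..<k} r (pick R i) else i)" for i
    have pick_R: "pick R i \<in> R" if "i < k" for i
      using that cR by (intro pick_in_set) simp
    have rp: "r (p i) = pick R i" and p_less: "p i < k" if "i < k" for i
    proof -
      show "r (p i) = pick R i"
        using pick_R[OF that] that r unfolding p_def R_def by (simp add: f_the_inv_into_f)
      have "p i \<in> {..<k}"
        unfolding p_def using that pick_R[OF that] r unfolding R_def
        by (simp only: if_True) (rule the_inv_into_into, auto)
      then show "p i < k" by simp
    qed
    have "inj_on p {..<k}"
    proof (rule inj_onI)
      fix i j assume ij: "i \<in> {..<k}" "j \<in> {..<k}" "p i = p j"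
      then have "pick R i = pick R j" using rp[of i] rp[of j] by simp
      then show "i = j"
        using pick_mono[of i R j] pick_mono[of j R i] ij cR
        by (cases i j rule: linorder_cases) auto
    qed
    moreover have "p ` {..<k} \<subseteq> {..<k}" using p_less by auto
    ultimately have "bij_betw p {..<k} {..<k}" by (simp add: bij_betw_def endo_inj_surj)
    then have p: "p permutes {..<k}" by (rule bij_imp_permutes) (simp add: p_def)
    define Q where "Q = permute_mat_rows p M"
    have Q_eq: "Q = append_cols (permute_mat_rows p K) (permute_mat_rows p L)"
      unfolding Q_def M_eq by (rule permute_mat_rows_append_cols[OF K L p])
    have "Q \<in> perm_pair_mats k"
      unfolding Q_eq perm_pair_mats_def using permutation_mat_permute_rows KL p by blast
    moreover have "M \<sim>\<^sub>r Q"
      unfolding row_equivalent_def Q_def using p dim_append_cols(1)[OF K L] M_eq by blast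
    ultimately have "Q \<in> \<C>" unfolding \<C>_eq perm_pair_rel_def using M by simp
    define \<kappa>' where "\<kappa>' = the_inv_into {..<k} \<kappa>"
    define \<mu>' where "\<mu>' = the_inv_into {..<k} \<mu>"
    have \<kappa>': "\<kappa> (\<kappa>' j) = j" "\<kappa>' j < k" if "j < k" for j
      using that f_the_inv_into_f_bij_betw[OF \<kappa>] bij_betwE[OF bij_betw_the_inv_into[OF \<kappa>]]
      unfolding \<kappa>'_def by auto
    have \<mu>': "\<mu> (\<mu>' j) = j" "\<mu>' j < k" if "j < k" for j
      using that f_the_inv_into_f_bij_betw[OF \<mu>] bij_betwE[OF bij_betw_the_inv_into[OF \<mu>]]
      unfolding \<mu>'_def by auto
    \<comment> \<open>Column \<open>j\<close> of \<open>K\<close> has its one in row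
      \<open>\<kappa>' j\<close>, so it is realised by the \<open>x\<close> of that point; the
      columns of \<open>L\<close> use \<open>\<mu>'\<close> and \<open>y\<close> likewise.\<close>
    define h where "h j = (if j < k then x (\<kappa>' j) else y (\<mu>' (j - k)))" for j
    \<comment> \<open>Inside each half the rankings give the order; between the halves every
      \<open>x\<close> is below every \<open>y\<close>.\<close>
    have h_mono: "h i < h j" if "i < j" "j < 2 * k" for i j
    proof (cases "j < k")
      case True
      then show ?thesis
        using that x \<kappa>'[of i] \<kappa>'[of j] unfolding h_def by simp
    next
      case False
      then have j: "j - k < k" using that by simp
      show ?thesis
      proof (cases "i < k")
        case True
        then show ?thesis using False j xy \<kappa>'[of i] \<mu>'[OF j] unfolding h_def by simp
      next
        case i: False
        then have "i - k < j - k" "i - k < k" using that by auto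
        then show ?thesis using False i j y \<mu>'[of "i - k"] \<mu>'[OF j] unfolding h_def by simp
      qed
    qed
    define H where "H = h ` {..<2 * k}"
    have pick_H: "pick H j = h j" if "j < 2 * k" for j
      unfolding H_def using h_mono that by (rule pick_strict_mono_image)
    have "inj_on h {..<2 * k}"
    proof (rule inj_onI)
      fix i j assume "i \<in> {..<2 * k}" "j \<in> {..<2 * k}" "h i = h j"
      then show "i = j" using h_mono[of i j] h_mono[of j i] by (cases i j rule: linorder_cases) auto
    qed
    then have cH: "card H = 2 * k" unfolding H_def by (simp add: card_image)
    have "h j < n" if "j < 2 * k" for j
    proof (cases "j < k")
      case True
      then show ?thesis using rxy \<kappa>'[of j] unfolding h_def S_def by simp
    next
      case False
      then have "j - k < k" using that by simp
      then show ?thesis using False rxy \<mu>'[of "j - k"] unfolding h_def S_def by simp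
    qed
    then have Hn: "H \<subseteq> {..<n}" unfolding H_def by auto
    have kept: "{i. i < dim_row A \<and> i \<in> R} = R" "{j. j < dim_col A \<and> j \<in> H} = H"
      using A Rm Hn by auto
    have dimQ: "dim_row Q = k" "dim_col Q = 2 * k"
      unfolding Q_def M_eq using dim_append_cols[OF K L] by simp_all
    have "submatrix A R H $$ (i, j) = 1" if ij: "i < k" "j < 2 * k" and Q1: "Q $$ (i, j) = 1" for i j
    proof -
      have "submatrix A R H $$ (i, j) = A $$ (r (p i), h j)"
        using submatrix_index[of i A R j H] kept cR cH ij rp[of i] pick_H[of j] by simp
      moreover have "Q $$ (i, j) = append_cols K L $$ (p i, j)"
        unfolding Q_def M_eq permute_mat_rows_def using ij dim_append_cols[OF K L] by simp
      then have one: "(if j < k then K $$ (p i, j) else L $$ (p i, j - k)) = 1"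
        using Q1 index_append_cols[OF K L p_less[OF ij(1)] ij(2)] by simp
      \<comment> \<open>A one of \<open>M\<close> in row \<open>p i\<close> and column
        \<open>j\<close> means that column \<open>j\<close> belongs to the point \<open>p i\<close>,
        so \<open>h j\<close> is the \<open>x\<close> or \<open>y\<close> of this point and lies in
        its row.\<close>
      have "h j \<in> S (r (p i))"
      proof (cases "j < k")
        case True
        then have "j = \<kappa> (p i)" using one K_one[OF p_less[OF ij(1)] True] by simp
        then have "\<kappa>' j = p i"
          unfolding \<kappa>'_def using \<kappa> p_less[OF ij(1)] by (simp add: the_inv_into_f_f bij_betw_def)
        then show ?thesis using True rxy p_less[OF ij(1)] unfolding h_def by simp
      next
        case False
        then have j: "j - k < k" using ij by simp
        then have "j - k = \<mu> (p i)" using False one L_one[OF p_less[OF ij(1)] j] by simp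
        then have "\<mu>' (j - k) = p i"
          unfolding \<mu>'_def using \<mu> p_less[OF ij(1)] by (simp add: the_inv_into_f_f bij_betw_def)
        then show ?thesis using False rxy p_less[OF ij(1)] unfolding h_def by simp
      qed
      ultimately show ?thesis unfolding S_def by simp
    qed
    moreover have "submatrix A R H \<in> carrier_mat (dim_row Q) (dim_col Q)"
      unfolding dimQ by (intro carrier_matI) (simp_all add: dim_submatrix kept cR cH)
    moreover have "is_submatrix (submatrix A R H) A"
      unfolding is_submatrix_def using A Rm Hn by blast
    ultimately have "mat_contains A Q"
      unfolding mat_contains_def dimQ by blast
    with \<open>Q \<in> \<C>\<close> show ?thesis by blast
  qed
  show ?thesis
    by (intro exI[of _ "real C"] allI impI ballI) (rule main)
qed

end
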